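(* A (real) vector lattice $E$ is Artinian if and only if it is lattice isomorphic to $\mathrm{Lex}(X)$ for some reverse well-founded forest $X$ with finite width.
   Context: An (order) ideal of a vector lattice $E$ is a linear subspace $I$ such that $|x|\le|y|$, $x\in E$, $y\in I$ imply $x\in I$. $E$ is Artinian if every decreasing sequence $(I_n)_{n\in\mathbb N}$ of ideals of $E$ is stationary (there is $k$ with $I_n=I_k$ for all $n\ge k$). A poset $X$ is well-founded if every nonempty subset of $X$ has a minimal element; it is reverse well-founded if the reversed order is well-founded, i.e. every nonempty subset has a maximal element. $X$ is a forest if $\{y\in X: y\le x\}$ is totally ordered for every $x\in X$. $X$ has finite width if every antichain (set of pairwise incomparable elements) in $X$ is finite. For a poset $X$, $\mathbb R^X_{\mathrm{lex}}$ is the vector space of all functions $f:X\to\mathbb R$ whose support $\mathrm{supp}(f)=\{x: f(x)\neq 0\}$ is well-founded, ordered by the cone of those $f$ such that $f(x)>0$ for every minimal element $x$ of $\mathrm{supp}(f)$. If $X$ is a forest, $\mathbb R^X_{\mathrm{lex}}$ is a vector lattice, and $\mathrm{Lex}(X)$ denotes its sublattice of all finitely supported functions. *)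

theory Defs
  imports Complex_Main "HOL-Library.Lattice_Algebras"
begin

class vector_lattice = ordered_real_vector + lattice_ab_group_add_abs

definition order_ideal :: "'a::vector_lattice set \<Rightarrow> bool" where
  "order_ideal I \<longleftrightarrow> subspace I \<and> (\<forall>x y. \<bar>x\<bar> \<le> \<bar>y\<bar> \<longrightarrow> y \<in> I \<longrightarrow> x \<in> I)"

definition artinian :: "'a::vector_lattice itself \<Rightarrow> bool" where
  "artinian _ \<longleftrightarrow>
     (\<forall>I :: nat \<Rightarrow> 'a set. (\<forall>n. order_ideal (I n)) \<and> decseq I \<longrightarrow> (\<exists>k. \<forall>n\<ge>k. I n = I k))"

text \<open>
  A poset is a carrier set \<open>X\<close> together with a relation \<open>r\<close> such that \<open>partial_order_on X r\<close>;
  \<open>(x, y) \<in> r\<close> means \<open>x \<le> y\<close>, and \<open>r \<subseteq> X \<times> X\<close> is part of \<^const>\<open>partial_order_on\<close>.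
\<close>

definition minimal_in :: "'x rel \<Rightarrow> 'x set \<Rightarrow> 'x \<Rightarrow> bool" where
  "minimal_in r S m \<longleftrightarrow> m \<in> S \<and> (\<forall>y\<in>S. (y, m) \<in> r \<longrightarrow> y = m)"

definition well_founded_on :: "'x set \<Rightarrow> 'x rel \<Rightarrow> bool" where
  "well_founded_on X r \<longleftrightarrow> (\<forall>S\<subseteq>X. S \<noteq> {} \<longrightarrow> (\<exists>m. minimal_in r S m))"

definition forest_on :: "'x set \<Rightarrow> 'x rel \<Rightarrow> bool" where
  "forest_on X r \<longleftrightarrow> partial_order_on X r \<and> (\<forall>x\<in>X. total_on {y \<in> X. (y, x) \<in> r} r)"

definition antichain_on :: "'x set \<Rightarrow> 'x rel \<Rightarrow> 'x set \<Rightarrow> bool" where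
  "antichain_on X r A \<longleftrightarrow>
     A \<subseteq> X \<and> (\<forall>x\<in>A. \<forall>y\<in>A. x \<noteq> y \<longrightarrow> (x, y) \<notin> r \<and> (y, x) \<notin> r)"

definition finite_width :: "'x set \<Rightarrow> 'x rel \<Rightarrow> bool" where
  "finite_width X r \<longleftrightarrow> (\<forall>A. antichain_on X r A \<longrightarrow> finite A)"

definition rev_wf_forest_finite_width :: "'x set \<Rightarrow> 'x rel \<Rightarrow> bool" where
  "rev_wf_forest_finite_width X r \<longleftrightarrow>
     forest_on X r \<and> well_founded_on X (r\<inverse>) \<and> finite_width X r"

text \<open>
  A function on the carrier \<open>X\<close> is represented by its extension by zero to the whole type, so
  the vector space operations are the pointwise ones.
\<close>

definition supp :: "('x \<Rightarrow> real) \<Rightarrow> 'x set" where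
  "supp f = {x. f x \<noteq> 0}"

definition lex_space :: "'x set \<Rightarrow> 'x rel \<Rightarrow> ('x \<Rightarrow> real) set" where
  "lex_space X r = {f. supp f \<subseteq> X \<and> well_founded_on (supp f) r}"

definition lex_cone :: "'x set \<Rightarrow> 'x rel \<Rightarrow> ('x \<Rightarrow> real) set" where
  "lex_cone X r = {f \<in> lex_space X r. \<forall>x. minimal_in r (supp f) x \<longrightarrow> f x > 0}"

text \<open>The built-in \<open>\<le>\<close> on functions is pointwise; the order used here is this one.\<close>

definition lex_le :: "'x set \<Rightarrow> 'x rel \<Rightarrow> ('x \<Rightarrow> real) \<Rightarrow> ('x \<Rightarrow> real) \<Rightarrow> bool" where
  "lex_le X r f g \<longleftrightarrow> (\<lambda>x. g x - f x) \<in> lex_cone X r"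

definition Lex :: "'x set \<Rightarrow> 'x rel \<Rightarrow> ('x \<Rightarrow> real) set" where
  "Lex X r = {f \<in> lex_space X r. finite (supp f)}"

definition is_join :: "'f set \<Rightarrow> ('f \<Rightarrow> 'f \<Rightarrow> bool) \<Rightarrow> 'f \<Rightarrow> 'f \<Rightarrow> 'f \<Rightarrow> bool" where
  "is_join S le f g h \<longleftrightarrow>
     h \<in> S \<and> le f h \<and> le g h \<and> (\<forall>k\<in>S. le f k \<and> le g k \<longrightarrow> le h k)"

definition is_meet :: "'f set \<Rightarrow> ('f \<Rightarrow> 'f \<Rightarrow> bool) \<Rightarrow> 'f \<Rightarrow> 'f \<Rightarrow> 'f \<Rightarrow> bool" where
  "is_meet S le f g h \<longleftrightarrow>
     h \<in> S \<and> le h f \<and> le h g \<and> (\<forall>k\<in>S. le k f \<and> le k g \<longrightarrow> le k h)"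

text \<open>
  A lattice isomorphism onto \<open>Lex X r\<close> is a linear bijection that preserves binary joins and
  meets. Linearity is stated coordinatewise, which is the same as linearity for the pointwise
  operations on functions.
\<close>

definition lattice_iso_Lex ::
    "('a::vector_lattice \<Rightarrow> 'x \<Rightarrow> real) \<Rightarrow> 'x set \<Rightarrow> 'x rel \<Rightarrow> bool" where
  "lattice_iso_Lex T X r \<longleftrightarrow>
     bij_betw T UNIV (Lex X r) \<and>
     (\<forall>x. linear (\<lambda>v. T v x)) \<and>
     (\<forall>u v. is_join (Lex X r) (lex_le X r) (T u) (T v) (T (sup u v))) \<and>
     (\<forall>u v. is_meet (Lex X r) (lex_le X r) (T u) (T v) (T (inf u v)))"

definition isomorphic_to_Lex :: "'a::vector_lattice itself \<Rightarrow> 'x set \<Rightarrow> 'x rel \<Rightarrow> bool" where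
  "isomorphic_to_Lex _ X r \<longleftrightarrow> (\<exists>T :: 'a \<Rightarrow> 'x \<Rightarrow> real. lattice_iso_Lex T X r)"

end

theory Submission
  imports Defs
begin

text \<open>
  In \<open>Lex X\<close> an ideal is determined by the up-set of those \<open>x\<close> whose unit vector it contains, and
  reverse well-foundedness with finite width forces decreasing sequences of up-sets to stabilise.

  Conversely, let \<open>E\<close> be Artinian and call \<open>u > 0\<close> join-irreducible if the ideal \<open>\<langle>u\<rangle>\<close> it generates is
  not a sum of two smaller ones. Then the elements not dominating \<open>u\<close> form a subspace, \<open>\<langle>u\<rangle>\<close> modulo
  its part in that subspace is one-dimensional, and two join-irreducible elements generate
  comparable ideals or are disjoint. One representative for each join-irreducible principal ideal,
  ordered by reverse inclusion of the ideals, gives \<open>X\<close>. Well-founded induction on principal ideals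
  shows that \<open>X\<close> spans \<open>E\<close>: a positive \<open>v\<close> is the sum of two elements with smaller ideals, or it
  differs from a multiple of an element of \<open>X\<close> by an element with a smaller ideal. Coordinates with
  respect to the basis \<open>X\<close> are the isomorphism.
\<close>

section \<open>Principal ideals and join-irreducible elements\<close>

text \<open>That is, \<open>y\<close> lies in the order ideal generated by \<open>x\<close>.\<close>

definition dominates :: "'a::vector_lattice \<Rightarrow> 'a \<Rightarrow> bool" where
  "dominates x y \<longleftrightarrow> (\<exists>c>0. \<bar>y\<bar> \<le> c *\<^sub>R \<bar>x\<bar>)"

text \<open>Only decompositions of \<open>u\<close> itself into nonnegative parts are tested;
  \<open>join_irreducible_split\<close> extends this to every sum that dominates
  \<open>u\<close>.\<close>

definition join_irreducible :: "'a::vector_lattice \<Rightarrow> bool" where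
  "join_irreducible u \<longleftrightarrow>
     0 < u \<and> (\<forall>a b. 0 \<le> a \<longrightarrow> 0 \<le> b \<longrightarrow> u = a + b \<longrightarrow> dominates a u \<or> dominates b u)"

section \<open>The domination preorder and principal ideals\<close>

lemma abs_scaleR_le: "\<bar>c *\<^sub>R x\<bar> \<le> \<bar>c\<bar> *\<^sub>R \<bar>x\<bar>" for x :: "'a::vector_lattice"
proof -
  have pos: "\<bar>c *\<^sub>R y\<bar> \<le> c *\<^sub>R \<bar>y\<bar>" if "c \<ge> 0" for c and y :: 'a
  proof (rule abs_leI)
    show "c *\<^sub>R y \<le> c *\<^sub>R \<bar>y\<bar>" using that by (intro scaleR_left_mono abs_ge_self)
    have "c *\<^sub>R (- y) \<le> c *\<^sub>R \<bar>y\<bar>" using that by (intro scaleR_left_mono abs_ge_minus_self)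
    then show "- (c *\<^sub>R y) \<le> c *\<^sub>R \<bar>y\<bar>" by simp
  qed
  show ?thesis
  proof (cases "c \<ge> 0")
    case True then show ?thesis using pos by simp
  next
    case False
    then have "\<bar>(-c) *\<^sub>R (- x)\<bar> \<le> (-c) *\<^sub>R \<bar>- x\<bar>" by (intro pos) simp
    then show ?thesis using False by simp
  qed
qed

lemma dominates_refl [simp]: "dominates x x"
  unfolding dominates_def by (rule exI[of _ 1]) simp

lemma dominates_zero [simp]: "dominates x 0"
  unfolding dominates_def by (rule exI[of _ 1]) simp

lemma dominates_minus [simp]: "dominates (- x) y \<longleftrightarrow> dominates x y" "dominates x (- y) \<longleftrightarrow> dominates x y"
  unfolding dominates_def by simp_all

lemma dominates_trans:
  assumes "dominates x y" "dominates y z" shows "dominates x z"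
proof -
  obtain c d where *: "c > 0" "d > 0" "\<bar>y\<bar> \<le> c *\<^sub>R \<bar>x\<bar>" "\<bar>z\<bar> \<le> d *\<^sub>R \<bar>y\<bar>"
    using assms unfolding dominates_def by auto
  have "\<bar>z\<bar> \<le> d *\<^sub>R (c *\<^sub>R \<bar>x\<bar>)"
    using * by (meson order_trans scaleR_left_mono less_imp_le)
  with * show ?thesis unfolding dominates_def by (intro exI[of _ "d * c"]) simp
qed

lemma dominates_mono: "\<bar>y\<bar> \<le> \<bar>x\<bar> \<Longrightarrow> dominates x y"
  unfolding dominates_def by (rule exI[of _ 1]) simp

lemma dominates_scaleR: "dominates x (c *\<^sub>R x)"
proof -
  have "\<bar>c *\<^sub>R x\<bar> \<le> \<bar>c\<bar> *\<^sub>R \<bar>x\<bar>" by (rule abs_scaleR_le)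
  also have "\<dots> \<le> (\<bar>c\<bar> + 1) *\<^sub>R \<bar>x\<bar>" by (rule scaleR_right_mono) auto
  finally show ?thesis unfolding dominates_def by (intro exI[of _ "\<bar>c\<bar> + 1"]) auto
qed

lemma dominates_add:
  assumes "dominates x y" "dominates x z" shows "dominates x (y + z)"
proof -
  obtain c d where *: "c > 0" "d > 0" "\<bar>y\<bar> \<le> c *\<^sub>R \<bar>x\<bar>" "\<bar>z\<bar> \<le> d *\<^sub>R \<bar>x\<bar>"
    using assms unfolding dominates_def by auto
  have "\<bar>y + z\<bar> \<le> \<bar>y\<bar> + \<bar>z\<bar>" by (rule abs_triangle_ineq)
  also have "\<dots> \<le> (c + d) *\<^sub>R \<bar>x\<bar>" using * by (simp add: scaleR_add_left add_mono)
  finally show ?thesis using * unfolding dominates_def by (intro exI[of _ "c + d"]) auto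
qed

lemma order_ideal_dominates: "order_ideal {y. dominates x y}"
  unfolding order_ideal_def subspace_def
  by (auto intro: dominates_add dominates_trans[OF _ dominates_scaleR] dominates_trans[OF _ dominates_mono])

lemma dominates_zero_left: "dominates 0 x \<Longrightarrow> x = 0"
  unfolding dominates_def by simp

section \<open>Disjoint elements\<close>

lemma inf_scaleR_zero:
  fixes x y :: "'a::vector_lattice"
  assumes "0 \<le> x" "0 \<le> y" "inf x y = 0" "z \<le> c *\<^sub>R y" "0 \<le> z" "c > 0"
  shows "inf x z = 0"
proof (rule antisym)
  define t where "t = inf x z"
  \<comment> \<open>Since \<open>d\<close> exceeds both \<open>1\<close> and \<open>c\<close>,
    scaling \<open>t\<close> by \<open>1 / d\<close> keeps it below \<open>x\<close> and brings it
    below \<open>y\<close>.\<close>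
  define d where "d = c + 1"
  have d: "d > 0" using \<open>c > 0\<close> unfolding d_def by simp
  have t0: "0 \<le> t" using assms by (simp add: t_def)
  have "t \<le> x" "t \<le> z" by (simp_all add: t_def)
  have "(1 / d) *\<^sub>R t \<le> 1 *\<^sub>R t" using t0 assms by (intro scaleR_right_mono) (auto simp: d_def)
  then have 1: "(1 / d) *\<^sub>R t \<le> x" using \<open>t \<le> x\<close> by auto
  have "c *\<^sub>R y \<le> d *\<^sub>R y" using assms by (intro scaleR_right_mono) (auto simp: d_def)
  then have "t \<le> d *\<^sub>R y" using \<open>t \<le> z\<close> assms by auto
  then have "(1 / d) *\<^sub>R t \<le> (1 / d) *\<^sub>R (d *\<^sub>R y)" using d by (intro scaleR_left_mono) auto
  then have "(1 / d) *\<^sub>R t \<le> y" using d by simp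
  with 1 have "(1 / d) *\<^sub>R t \<le> 0" using assms(3) by (metis le_inf_iff)
  then have "d *\<^sub>R ((1 / d) *\<^sub>R t) \<le> d *\<^sub>R 0" using d by (intro scaleR_left_mono) auto
  then show "inf x z \<le> 0" using d by (simp add: t_def)
  show "0 \<le> inf x z" using assms by simp
qed

text \<open>Distributivity turns the right side into the meet of four sums, each of them above
  \<open>inf (a + b) c\<close>.\<close>

lemma inf_add_le:
  fixes a b c :: "'a::vector_lattice"
  assumes "0 \<le> a" "0 \<le> b" "0 \<le> c"
  shows "inf (a + b) c \<le> inf a c + inf b c"
proof -
  have "inf a c + inf b c = inf (inf (a + b) (c + b)) (inf (a + c) (c + c))"
    by (simp only: add_inf_distrib_left add_inf_distrib_right)
  moreover have "inf (a + b) c \<le> c + b" "inf (a + b) c \<le> a + c" "inf (a + b) c \<le> c + c"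
    using assms by (auto intro: le_infI2 simp: add_increasing add_increasing2)
  ultimately show ?thesis by simp
qed

text \<open>Disjoint complements supply the decreasing ideals in
  \<open>artinian_finite_disjoint\<close>. Closure under sums comes from \<open>inf_add_le\<close>,
  closure under domination from \<open>inf_scaleR_zero\<close>.\<close>

lemma order_ideal_disjoint:
  fixes x :: "'a::vector_lattice" shows "order_ideal {v. inf \<bar>v\<bar> \<bar>x\<bar> = 0}"
proof -
  have dom: "inf \<bar>w\<bar> \<bar>x\<bar> = 0" if h: "inf \<bar>v\<bar> \<bar>x\<bar> = 0" "dominates v w" for v w :: 'a
  proof -
    obtain c where c: "c > 0" "\<bar>w\<bar> \<le> c *\<^sub>R \<bar>v\<bar>" using h(2) unfolding dominates_def by auto
    have "inf \<bar>x\<bar> \<bar>v\<bar> = 0" using h(1) by (simp only: inf_commute)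
    then have "inf \<bar>x\<bar> \<bar>w\<bar> = 0"
      by (rule inf_scaleR_zero[OF abs_ge_zero abs_ge_zero _ c(2) abs_ge_zero c(1)])
    then show ?thesis by (simp only: inf_commute)
  qed
  have add: "inf \<bar>v + w\<bar> \<bar>x\<bar> = 0" if "inf \<bar>v\<bar> \<bar>x\<bar> = 0" "inf \<bar>w\<bar> \<bar>x\<bar> = 0" for v w :: 'a
  proof (rule antisym)
    have "inf \<bar>v + w\<bar> \<bar>x\<bar> \<le> inf (\<bar>v\<bar> + \<bar>w\<bar>) \<bar>x\<bar>"
      by (rule inf_mono) (auto simp: abs_triangle_ineq)
    also have "\<dots> \<le> inf \<bar>v\<bar> \<bar>x\<bar> + inf \<bar>w\<bar> \<bar>x\<bar>" by (rule inf_add_le) auto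
    finally show "inf \<bar>v + w\<bar> \<bar>x\<bar> \<le> 0" using that by simp
  qed auto
  have zero: "inf \<bar>0\<bar> \<bar>x\<bar> = 0" by (simp add: inf_absorb1)
  show ?thesis unfolding order_ideal_def subspace_def mem_Collect_eq
    using zero add dom[OF _ dominates_scaleR] dom[OF _ dominates_mono] by blast
qed

text \<open>The meet is the translate by \<open>- nprt x\<close> of \<open>inf x 0\<close>, which is
  \<open>nprt x\<close>.\<close>

lemma inf_pprt_nprt: "inf (pprt x) (- nprt x) = 0" for x :: "'a::vector_lattice"
proof -
  have "inf (pprt x) (- nprt x) = inf (pprt x + nprt x) 0 - nprt x"
    using add_inf_distrib_right[of "pprt x + nprt x" 0 "- nprt x"] by simp
  also have "pprt x + nprt x = x" by (rule prts[symmetric])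
  finally show ?thesis by (simp add: nprt_def)
qed

section \<open>Join-irreducible elements\<close>

lemma join_irreducible_pos: "join_irreducible u \<Longrightarrow> 0 < u"
  unfolding join_irreducible_def by simp

text \<open>Riesz decomposition: \<open>u\<close> lies below a multiple of |a| + |b|, and cutting it
  off at that multiple of |a| leaves a remainder below the multiple of |b|. The definition applies
  to these two parts.\<close>

lemma join_irreducible_split:
  assumes u: "join_irreducible u" and ab: "dominates (a + b) u"
  shows "dominates a u \<or> dominates b u"
proof -
  obtain c where c: "c > 0" "\<bar>u\<bar> \<le> c *\<^sub>R \<bar>a + b\<bar>" using ab unfolding dominates_def by auto
  have u0: "0 < u" using u by (rule join_irreducible_pos)
  then have "u \<le> c *\<^sub>R \<bar>a + b\<bar>" using c by simp
  also have "\<dots> \<le> c *\<^sub>R (\<bar>a\<bar> + \<bar>b\<bar>)" using c abs_triangle_ineq by (intro scaleR_left_mono) auto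
  finally have le: "u \<le> c *\<^sub>R \<bar>a\<bar> + c *\<^sub>R \<bar>b\<bar>" by (simp add: scaleR_add_right)
  have nn: "0 \<le> c *\<^sub>R \<bar>a\<bar>" "0 \<le> c *\<^sub>R \<bar>b\<bar>" using c by (auto intro: scaleR_nonneg_nonneg)
  define a' where "a' = inf u (c *\<^sub>R \<bar>a\<bar>)"
  have a0: "0 \<le> a'" "0 \<le> u - a'" using u0 nn unfolding a'_def by (simp_all only: le_inf_iff less_imp_le diff_ge_0_iff_ge inf_le1 simp_thms)
  have "u - c *\<^sub>R \<bar>b\<bar> \<le> a'" using le nn by (simp add: a'_def algebra_simps)
  then have "u - a' \<le> c *\<^sub>R \<bar>b\<bar>" by (simp add: algebra_simps)
  then have db: "dominates b (u - a')" using c a0 unfolding dominates_def by auto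
  have "a' \<le> c *\<^sub>R \<bar>a\<bar>" by (simp add: a'_def)
  then have da: "dominates a a'" using c a0 unfolding dominates_def by auto
  have "u = a' + (u - a')" by simp
  with u a0 have "dominates a' u \<or> dominates (u - a') u" unfolding join_irreducible_def by blast
  with da db show ?thesis using dominates_trans by blast
qed

text \<open>Closure under sums is the contrapositive of \<open>join_irreducible_split\<close>.
  Working modulo this subspace isolates a leading coefficient in
  \<open>minimal_coefficient\<close>.\<close>

lemma subspace_not_dominates:
  assumes "join_irreducible u" shows "subspace {v. \<not> dominates v u}"
  unfolding subspace_def
  using join_irreducible_split[OF assms] join_irreducible_pos[OF assms] dominates_zero_left
  by (auto intro: dominates_trans[OF dominates_scaleR])

text \<open>One of the parts \<open>pprt w\<close> and \<open>nprt w\<close> dominates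
  \<open>u\<close>, hence \<open>w\<close>, hence the other part. As the two parts are disjoint, the
  dominated one vanishes.\<close>

lemma join_irreducible_nonneg_or_nonpos:
  assumes u: "join_irreducible u" and w: "dominates u w" "dominates w u"
  shows "0 \<le> w \<or> w \<le> 0"
proof -
  have "w = pprt w + nprt w" by (rule prts)
  with w have "dominates (pprt w) u \<or> dominates (nprt w) u"
    using join_irreducible_split[OF u] by metis
  then show ?thesis
  proof
    assume *: "dominates (pprt w) u"
    have "dominates w (nprt w)"
      by (rule dominates_mono) (simp add: abs_prts)
    then have "dominates (pprt w) (nprt w)" using * w dominates_trans by blast
    then obtain c where "c > 0" "- nprt w \<le> c *\<^sub>R pprt w"
      unfolding dominates_def by auto
    then have "inf (- nprt w) (- nprt w) = 0"
      using inf_scaleR_zero[of "- nprt w" "pprt w" "- nprt w" c] inf_pprt_nprt[of w]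
      by (simp add: inf_commute)
    then show ?thesis by (simp add: zero_le_iff_zero_nprt)
  next
    assume *: "dominates (nprt w) u"
    have "dominates w (pprt w)"
      by (rule dominates_mono) (simp add: abs_prts)
    then have "dominates (nprt w) (pprt w)" using * w dominates_trans by blast
    then obtain c where "c > 0" "pprt w \<le> c *\<^sub>R (- nprt w)"
      unfolding dominates_def by auto
    then have "inf (pprt w) (pprt w) = 0"
      using inf_scaleR_zero[of "pprt w" "- nprt w" "pprt w" c] inf_pprt_nprt[of w]
      by (simp add: inf_commute)
    then show ?thesis by (simp add: le_zero_iff_zero_pprt)
  qed
qed

text \<open>Removing the meet \<open>m\<close> from \<open>j\<close> and \<open>k\<close> leaves
  disjoint elements. Either \<open>m\<close> dominates \<open>j\<close> or \<open>k\<close>, which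
  makes them comparable, or both remainders dominate the originals and disjointness carries
  over.\<close>

lemma join_irreducible_comparable_or_disjoint:
  assumes j: "join_irreducible j" and k: "join_irreducible k"
  shows "dominates j k \<or> dominates k j \<or> inf j k = 0"
proof -
  define m where "m = inf j k"
  have pos: "0 < j" "0 < k" using j k by (simp_all add: join_irreducible_pos)
  then have pos': "0 \<le> j" "0 \<le> k" by simp_all
  have m: "0 \<le> m" "m \<le> j" "m \<le> k" using pos' by (simp_all add: m_def)
  have jm: "dominates j m" "dominates k m" using m pos by (auto intro!: dominates_mono)
  have "dominates (j - m) j \<or> dominates m j"
    using join_irreducible_split[OF j, of "j - m" m] by simp
  moreover have "dominates (k - m) k \<or> dominates m k"
    using join_irreducible_split[OF k, of "k - m" m] by simp
  moreover have "inf j k = 0" if h: "dominates (j - m) j" "dominates (k - m) k"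
  proof -
    obtain c where c: "c > 0" "j \<le> c *\<^sub>R (j - m)"
      using h(1) m pos' unfolding dominates_def by auto
    obtain d where d: "d > 0" "k \<le> d *\<^sub>R (k - m)"
      using h(2) m pos' unfolding dominates_def by auto
    have "inf (j - m) (k - m) = 0"
      using add_inf_distrib_right[of "j - m" "k - m" m] by (simp flip: m_def)
    then have "inf (k - m) j = 0"
      using c m pos inf_scaleR_zero[of "k - m" "j - m" j c] by (simp add: inf_commute)
    then show ?thesis
      using d m pos inf_scaleR_zero[of j "k - m" k d] by (simp add: inf_commute)
  qed
  ultimately show ?thesis using jm dominates_trans by blast
qed

text \<open>The quotient of the ideal generated by \<open>u\<close> by its largest proper ideal is the real line.\<close>

lemma join_irreducible_scaleR_approx:
  assumes u: "join_irreducible u" and v: "0 \<le> v" "dominates u v"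
  obtains l where "\<not> dominates (v - l *\<^sub>R u) u"
proof -
  have u0: "0 < u" using u by (rule join_irreducible_pos)
  obtain n where n: "n > 0" "v \<le> n *\<^sub>R u" using v u0 unfolding dominates_def by auto
  define A where "A = {t. t *\<^sub>R u \<le> v}"
  have mono: "s \<le> t" if "s *\<^sub>R u \<le> t *\<^sub>R u" for s t
  proof (rule ccontr)
    assume "\<not> s \<le> t"
    then have st: "s - t > 0" by simp
    have "(s - t) *\<^sub>R u \<le> 0" using that by (simp add: scaleR_diff_left)
    then have "(1 / (s - t)) *\<^sub>R ((s - t) *\<^sub>R u) \<le> (1 / (s - t)) *\<^sub>R 0"
      using st by (intro scaleR_left_mono) auto
    then show False using st u0 by simp
  qed
  have "0 \<in> A" using v by (simp add: A_def)
  have bdd: "t \<le> b" if "t \<in> A" "v \<le> b *\<^sub>R u" for t b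
    using that mono[of t b] unfolding A_def by auto
  then have bdd': "bdd_above A" using n by (intro bdd_aboveI[of _ n])
  define l where "l = Sup A"
  define w where "w = v - l *\<^sub>R u"
  have "\<not> dominates w u"
  proof
    assume d: "dominates w u"
    have "dominates u w" unfolding w_def
      using dominates_add[OF v(2), of "- (l *\<^sub>R u)"] dominates_scaleR by auto
    then have cases: "0 \<le> w \<or> w \<le> 0" using join_irreducible_nonneg_or_nonpos[OF u] d by blast
    obtain c where c: "c > 0" "u \<le> c *\<^sub>R \<bar>w\<bar>" using d u0 unfolding dominates_def by auto
    \<comment> \<open>A dominating \<open>w\<close> is at least \<open>(1 / c) *\<^sub>R u\<close>
      in absolute value. According to its sign, \<open>l + 1 / c\<close> would lie in
      \<open>A\<close> or \<open>l - 1 / c\<close> would bound \<open>A\<close>, against the choice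
      of \<open>l\<close> as supremum.\<close>
    have "(1 / c) *\<^sub>R u \<le> (1 / c) *\<^sub>R (c *\<^sub>R \<bar>w\<bar>)" using c by (intro scaleR_left_mono) auto
    then have cw: "(1 / c) *\<^sub>R u \<le> \<bar>w\<bar>" using c by simp
    from cases show False
    proof
      assume "0 \<le> w"
      with cw have "(l + 1 / c) *\<^sub>R u \<le> v" by (simp add: w_def algebra_simps)
      then have "l + 1 / c \<in> A" by (simp add: A_def)
      then have "l + 1 / c \<le> l" unfolding l_def using bdd' by (rule cSup_upper)
      then show False using c by simp
    next
      assume "w \<le> 0"
      with cw have "v \<le> (l - 1 / c) *\<^sub>R u" by (simp add: w_def algebra_simps)
      then have "Sup A \<le> l - 1 / c" using bdd \<open>0 \<in> A\<close> by (intro cSup_least) auto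
      then show False using c by (simp add: l_def)
    qed
  qed
  then show ?thesis using that by (simp add: w_def)
qed

section \<open>Lexicographic spaces are Artinian\<close>

text \<open>If \<open>x\<close> is not minimal, restrict to the elements below some smaller
  \<open>y\<close>. This removes \<open>x\<close>, and minimality in the restricted set passes back
  by transitivity.\<close>

lemma finite_minimal_in_below:
  assumes r: "partial_order_on X r" and S: "finite S" "S \<subseteq> X" "x \<in> S"
  obtains m where "minimal_in r S m" "(m, x) \<in> r"
proof -
  have tr: "trans r" "antisym r" "refl_on X r"
    using r by (auto simp: partial_order_on_def preorder_on_def)
  have "\<exists>m. minimal_in r S m \<and> (m, x) \<in> r"
    using S
  proof (induction S arbitrary: x rule: finite_psubset_induct)
    case (psubset S)
    show ?case
    proof (cases "minimal_in r S x")
      case True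
      then show ?thesis using psubset.prems tr(3) by (auto simp: refl_on_def)
    next
      case False
      then obtain y where y: "y \<in> S" "(y, x) \<in> r" "y \<noteq> x"
        using psubset.prems unfolding minimal_in_def by auto
      define S' where "S' = {z \<in> S. (z, y) \<in> r}"
      have "x \<notin> S'" using y tr(2) by (auto simp: S'_def antisym_def)
      then have "S' \<subset> S" using psubset.prems by (auto simp: S'_def)
      moreover have "y \<in> S'" using y psubset.prems tr(3) by (auto simp: S'_def refl_on_def)
      ultimately obtain m where m: "minimal_in r S' m" "(m, y) \<in> r"
        using psubset.IH[of S' y] psubset.prems by blast
      have "minimal_in r S m"
        using m tr(1) unfolding minimal_in_def S'_def trans_def by blast
      moreover have "(m, x) \<in> r" using m y tr(1) by (meson transD)
      ultimately show ?thesis by blast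
    qed
  qed
  then show ?thesis using that by blast
qed

lemma finite_well_founded_on:
  assumes r: "partial_order_on X r" and S: "finite S" "S \<subseteq> X"
  shows "well_founded_on S r"
  unfolding well_founded_on_def
proof (intro allI impI)
  fix T assume T: "T \<subseteq> S" "T \<noteq> {}"
  then obtain x where x: "x \<in> T" by auto
  show "\<exists>m. minimal_in r T m"
    by (rule finite_minimal_in_below[OF r _ _ x]) (use T S finite_subset in auto)
qed

lemma Lex_iff:
  assumes "partial_order_on X r"
  shows "f \<in> Lex X r \<longleftrightarrow> supp f \<subseteq> X \<and> finite (supp f)"
  using finite_well_founded_on[OF assms] by (auto simp: Lex_def lex_space_def)

text \<open>The maximal members of the sequence form an antichain, hence occur among finitely many
  indices, and every later member lies below one of them.\<close>

lemma rev_wf_finite_width_increasing_pair: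
  fixes x :: "nat \<Rightarrow> 'x"
  assumes X: "rev_wf_forest_finite_width X r" and x: "range x \<subseteq> X"
  shows "\<exists>i j. i < j \<and> (x j, x i) \<in> r"
proof -
  have po: "trans r" "antisym r" "refl_on X r"
    and wf: "well_founded_on X (r\<inverse>)" and fw: "finite_width X r"
    using X by (auto simp: rev_wf_forest_finite_width_def forest_on_def partial_order_on_def preorder_on_def)
  define M where "M = {m \<in> range x. \<forall>y\<in>range x. (m, y) \<in> r \<longrightarrow> y = m}"
  have "antichain_on X r M"
    using x by (auto simp: antichain_on_def M_def)
  then have "finite M" using fw by (simp add: finite_width_def)
  have "M \<subseteq> range x" by (auto simp: M_def)
  then obtain I where I: "finite I" "M = x ` I"
    using finite_subset_image[OF \<open>finite M\<close>, of x UNIV] by auto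
  obtain N where N: "\<And>i. i \<in> I \<Longrightarrow> i < N"
    using I finite_nat_set_iff_bounded by auto
  define S where "S = {y \<in> range x. (x N, y) \<in> r}"
  have "x N \<in> S" using po x by (auto simp: S_def refl_on_def)
  moreover have "S \<subseteq> X" using x by (auto simp: S_def)
  ultimately obtain m where m: "minimal_in (r\<inverse>) S m"
    using wf unfolding well_founded_on_def by blast
  then have "m \<in> M" "(x N, m) \<in> r"
    using po(1) unfolding minimal_in_def S_def M_def by (auto dest: transD)
  then show ?thesis using I N by blast
qed

text \<open>At a minimal point of the support of the difference, both \<open>g - f\<close> and
  \<open>f - g\<close> would be positive.\<close>

lemma lex_le_antisym:
  assumes "lex_le X r f g" "lex_le X r g f"
  shows "f = g"
proof (rule ccontr)
  let ?h = "\<lambda>x. g x - f x"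
  assume "f \<noteq> g"
  then obtain x where "f x \<noteq> g x" by (auto simp: fun_eq_iff)
  then have "x \<in> supp ?h" by (simp add: supp_def)
  then have "supp ?h \<noteq> {}" by blast
  moreover have "well_founded_on (supp ?h) r"
    using assms(1) by (simp add: lex_le_def lex_cone_def lex_space_def)
  ultimately obtain m where m: "minimal_in r (supp ?h) m"
    unfolding well_founded_on_def by blast
  have "supp (\<lambda>x. f x - g x) = supp ?h" by (auto simp: supp_def)
  then have "g m - f m > 0" "f m - g m > 0"
    using m assms by (auto simp: lex_le_def lex_cone_def)
  then show False by simp
qed

section \<open>Ideals of a lattice isomorphic to \<open>Lex X r\<close>\<close>

locale Lex_isomorphism =
  fixes T :: "'a::vector_lattice \<Rightarrow> 'x \<Rightarrow> real" and X r
  assumes iso: "lattice_iso_Lex T X r" and po: "partial_order_on X r"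
begin

lemma T_in: "T v \<in> Lex X r"
  using iso by (auto simp: lattice_iso_Lex_def bij_betw_def)

lemma supp_subset: "supp (T v) \<subseteq> X" and finite_supp: "finite (supp (T v))"
  using T_in[of v] Lex_iff[OF po] by auto

lemma T_inj: "T u = T v \<longleftrightarrow> u = v"
  using iso by (auto simp: lattice_iso_Lex_def bij_betw_def dest: injD)

lemma T_add: "T (u + v) x = T u x + T v x" and T_scaleR: "T (c *\<^sub>R u) x = c * T u x"
  and T_diff: "T (u - v) x = T u x - T v x"
  and T_zero: "T 0 x = 0" and T_sum: "T (sum f A) x = (\<Sum>a\<in>A. T (f a) x)"
proof -
  have lin: "linear (\<lambda>v. T v x)" using iso by (auto simp: lattice_iso_Lex_def)
  show "T (u + v) x = T u x + T v x" "T (c *\<^sub>R u) x = c * T u x"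
    "T (u - v) x = T u x - T v x" "T 0 x = 0" "T (sum f A) x = (\<Sum>a\<in>A. T (f a) x)"
    using linear_add[OF lin] linear_scale[OF lin] linear_diff[OF lin]
      linear_0[OF lin] linear_sum[OF lin] by auto
qed

text \<open>The order is recovered from joins: if \<open>T u\<close> lies below \<open>T v\<close>,
  then \<open>T v\<close> is a join of the two, and antisymmetry identifies it with
  \<open>T (sup u v)\<close>.\<close>

lemma le_iff: "u \<le> v \<longleftrightarrow> lex_le X r (T u) (T v)"
proof -
  have join: "is_join (Lex X r) (lex_le X r) (T u) (T v) (T (sup u v))"
    using iso by (auto simp: lattice_iso_Lex_def)
  show ?thesis
  proof
    assume "u \<le> v"
    then show "lex_le X r (T u) (T v)"
      using join by (simp add: is_join_def sup_absorb2)
  next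
    assume *: "lex_le X r (T u) (T v)"
    have "lex_le X r (T v) (T v)"
      by (auto simp: lex_le_def lex_cone_def lex_space_def supp_def well_founded_on_def minimal_in_def)
    with * join have "T (sup u v) = T v"
      by (intro lex_le_antisym[of X r]) (auto simp: is_join_def T_in)
    then have "sup u v = v" by (simp add: T_inj)
    then show "u \<le> v" by (metis sup_ge1)
  qed
qed

lemma nonneg_iff: "0 \<le> u \<longleftrightarrow> (\<forall>x. minimal_in r (supp (T u)) x \<longrightarrow> T u x > 0)"
  using T_in[of u] by (simp add: le_iff lex_le_def lex_cone_def Lex_def T_zero)

text \<open>For \<open>x\<close> outside \<open>X\<close> the indicator function has no preimage and
  the value is arbitrary.\<close>

definition unit :: "'x \<Rightarrow> 'a" where
  "unit x = inv_into UNIV T (\<lambda>y. if y = x then 1 else 0)"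

lemma T_unit: assumes "x \<in> X" shows "T (unit x) = (\<lambda>y. if y = x then 1 else 0)"
proof -
  have "supp (\<lambda>y. if y = x then 1 else 0) = {x}" by (auto simp: supp_def)
  then have "(\<lambda>y. if y = x then 1 else 0) \<in> Lex X r"
    using assms by (subst Lex_iff[OF po]) auto
  then have "(\<lambda>y. if y = x then 1 else 0) \<in> range T"
    using iso by (auto simp: lattice_iso_Lex_def bij_betw_def)
  then show ?thesis unfolding unit_def by (rule f_inv_into_f)
qed

lemma unit_nonneg: "x \<in> X \<Longrightarrow> 0 \<le> unit x"
  by (auto simp: nonneg_iff T_unit minimal_in_def supp_def split: if_splits)

lemma unit_expansion: "v = (\<Sum>x\<in>supp (T v). T v x *\<^sub>R unit x)"
proof -
  have "T v y = T (\<Sum>x\<in>supp (T v). T v x *\<^sub>R unit x) y" for y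
  proof -
    have "T (\<Sum>x\<in>supp (T v). T v x *\<^sub>R unit x) y = (\<Sum>x\<in>supp (T v). if y = x then T v x else 0)"
      unfolding T_sum T_scaleR using supp_subset[of v] by (intro sum.cong) (auto simp: T_unit)
    also have "\<dots> = T v y" using finite_supp[of v] by (auto simp: supp_def)
    finally show ?thesis by simp
  qed
  then show ?thesis using T_inj by blast
qed

text \<open>Below \<open>y\<close> lies a leading position \<open>m\<close> of \<open>v\<close>. The
  support of |v| reaches down to \<open>m\<close> or lower, so |v| has a positive leading
  coefficient at some \<open>z\<close> below \<open>x\<close>, and a large multiple of |v| exceeds
  \<open>unit x\<close>.\<close>

lemma abs_dominates_unit:
  assumes y: "y \<in> supp (T v)" and x: "x \<in> X" "(y, x) \<in> r"
  shows "\<exists>c. unit x \<le> c *\<^sub>R \<bar>v\<bar>"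
proof -
  have tr: "trans r" "antisym r" "refl_on X r"
    using po by (auto simp: partial_order_on_def preorder_on_def)
  define w where "w = \<bar>v\<bar>"
  obtain m where m: "minimal_in r (supp (T v)) m" "(m, y) \<in> r"
    using finite_minimal_in_below[OF po finite_supp supp_subset y] by blast
  then have mx: "(m, x) \<in> r" and mX: "m \<in> X" and Tm: "T v m \<noteq> 0"
    using x tr supp_subset[of v] by (auto simp: minimal_in_def supp_def dest: transD)
  have w: "0 \<le> w - v" "0 \<le> w + v"
    using abs_ge_self[of v] abs_ge_minus_self[of v] diff_ge_0_iff_ge[of w "- v"]
    unfolding w_def by (simp_all del: abs_ge_self abs_ge_minus_self)
  \<comment> \<open>Otherwise \<open>w - v\<close> and \<open>w + v\<close>, both nonnegative, would
    have the opposite leading coefficients \<open>- T v m\<close> and \<open>T v m\<close> at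
    \<open>m\<close>.\<close>
  have "\<exists>z. z \<in> supp (T w) \<and> (z, m) \<in> r"
  proof (rule ccontr)
    assume "\<not> ?thesis"
    then have z: "T w z = 0" if "(z, m) \<in> r" for z using that by (auto simp: supp_def)
    have v0: "T v z = 0" if "(z, m) \<in> r" "z \<noteq> m" for z
      using that m by (auto simp: minimal_in_def supp_def)
    have mm: "(m, m) \<in> r" using tr mX by (auto simp: refl_on_def)
    have "minimal_in r (supp (T (w - v))) m"
      using z[OF mm] v0 z Tm unfolding minimal_in_def supp_def T_diff by fastforce
    moreover have "minimal_in r (supp (T (w + v))) m"
      using z[OF mm] v0 z Tm unfolding minimal_in_def supp_def T_add by fastforce
    ultimately have "T (w - v) m > 0" "T (w + v) m > 0" using w nonneg_iff by simp_all
    moreover have "T w m = 0" using z tr mX by (auto simp: refl_on_def)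
    ultimately show False by (simp add: T_add T_diff)
  qed
  then obtain z' where z': "z' \<in> supp (T w)" "(z', m) \<in> r" by blast
  obtain z where z: "minimal_in r (supp (T w)) z" "(z, z') \<in> r"
    using finite_minimal_in_below[OF po finite_supp supp_subset z'(1)] .
  have zx: "(z, x) \<in> r" using z(2) z'(2) mx tr(1) by (blast dest: transD)
  have "0 \<le> w" by (simp add: w_def)
  then have Tz: "T w z > 0" using z nonneg_iff by blast
  \<comment> \<open>The factor 2 leaves the coefficient \<open>2 - 1\<close> of \<open>u\<close> at
    \<open>x\<close> positive in the case \<open>z = x\<close>.\<close>
  define c where "c = 2 / T w z"
  define u where "u = c *\<^sub>R w - unit x"
  have c: "c > 0" using Tz by (simp add: c_def)
  have Tu: "T u p = c * T w p - (if p = x then 1 else 0)" for p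
    using x by (simp add: u_def T_diff T_scaleR T_unit)
  have "0 \<le> u" unfolding nonneg_iff
  proof (intro allI impI)
    fix p assume p: "minimal_in r (supp (T u)) p"
    show "T u p > 0"
    proof (cases "z = x")
      case True
      have "supp (T u) = supp (T w)"
        using True Tz c by (auto simp: supp_def Tu c_def)
      then have "T w p > 0" using p \<open>0 \<le> w\<close> nonneg_iff by auto
      then show ?thesis using True Tz c by (auto simp: Tu c_def)
    next
      case False
      have zu: "z \<in> supp (T u)" using False Tz c by (auto simp: supp_def Tu)
      \<comment> \<open>A minimal \<open>p\<close> cannot be \<open>x\<close>, since
        \<open>z\<close> lies strictly below \<open>x\<close> in the same support.\<close>
      have px: "p \<noteq> x" using zu zx p False by (auto simp: minimal_in_def)
      have "minimal_in r (supp (T w)) p"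
        unfolding minimal_in_def
      proof (intro conjI ballI impI)
        show "p \<in> supp (T w)" using p px by (auto simp: minimal_in_def supp_def Tu)
        fix q assume q: "q \<in> supp (T w)" "(q, p) \<in> r"
        show "q = p"
        proof (cases "q = x")
          case True
          then have "(z, p) \<in> r" using zx q tr by (auto dest: transD)
          then have "z = p" using zu p by (auto simp: minimal_in_def)
          then show ?thesis using True q zx tr by (auto dest: antisymD)
        next
          case False
          then have "q \<in> supp (T u)" using q c by (auto simp: supp_def Tu)
          then show ?thesis using q p by (auto simp: minimal_in_def)
        qed
      qed
      then have "T w p > 0" using \<open>0 \<le> w\<close> nonneg_iff by auto
      then show ?thesis using px c by (simp add: Tu)
    qed
  qed
  then show ?thesis by (auto simp: u_def w_def)
qed

text \<open>For \<open>v = unit y\<close> this makes the positions of the unit vectors in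
  \<open>J\<close> an up-set; for general \<open>v\<close> it puts the whole support of each member
  into that up-set.\<close>

lemma unit_mem_ideal:
  assumes J: "order_ideal J" "v \<in> J" and y: "y \<in> supp (T v)" and x: "x \<in> X" "(y, x) \<in> r"
  shows "unit x \<in> J"
proof -
  obtain c where c: "unit x \<le> c *\<^sub>R \<bar>v\<bar>" using abs_dominates_unit[OF y x] by blast
  have sub: "subspace J" and sol: "\<And>a b. \<bar>a\<bar> \<le> \<bar>b\<bar> \<Longrightarrow> b \<in> J \<Longrightarrow> a \<in> J"
    using J by (auto simp: order_ideal_def)
  have "\<bar>v\<bar> \<in> J" using sol[of "\<bar>v\<bar>" v] J by simp
  then have "c *\<^sub>R \<bar>v\<bar> \<in> J" using sub by (simp add: subspace_scale)
  moreover have "\<bar>unit x\<bar> \<le> \<bar>c *\<^sub>R \<bar>v\<bar>\<bar>"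
    using c unit_nonneg[OF x(1)] abs_ge_self[of "c *\<^sub>R \<bar>v\<bar>"] by (simp del: abs_ge_self)
  ultimately show ?thesis by (rule sol[rotated])
qed

text \<open>Each member of \<open>I\<close> is a combination of unit vectors that themselves lie in
  \<open>I\<close>.\<close>

lemma ideal_subsetI:
  assumes I: "order_ideal I" and J: "order_ideal J"
    and sub: "\<And>x. x \<in> X \<Longrightarrow> unit x \<in> I \<Longrightarrow> unit x \<in> J"
  shows "I \<subseteq> J"
proof
  fix v assume v: "v \<in> I"
  have "T v x *\<^sub>R unit x \<in> J" if x: "x \<in> supp (T v)" for x
  proof -
    have "x \<in> X" using x supp_subset by auto
    moreover have "(x, x) \<in> r"
      using \<open>x \<in> X\<close> po by (auto simp: partial_order_on_def preorder_on_def refl_on_def)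
    ultimately have "unit x \<in> J" using unit_mem_ideal[OF I v x] sub by blast
    then show ?thesis using J by (auto simp: order_ideal_def subspace_scale)
  qed
  then have "(\<Sum>x\<in>supp (T v). T v x *\<^sub>R unit x) \<in> J"
    using J by (auto simp: order_ideal_def intro: subspace_sum)
  then show "v \<in> J" using unit_expansion[of v] by simp
qed

end

text \<open>A nonstationary sequence loses some unit vector after each index. Among the lost
  positions a later one lies below an earlier one, and \<open>unit_mem_ideal\<close> then restores
  the earlier unit vector after its loss.\<close>

lemma artinian_if_isomorphic_to_Lex:
  assumes X: "rev_wf_forest_finite_width X r" and "isomorphic_to_Lex TYPE('a::vector_lattice) X r"
  shows "artinian TYPE('a)"
proof -
  obtain T :: "'a \<Rightarrow> 'b \<Rightarrow> real" where T: "lattice_iso_Lex T X r"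
    using assms(2) by (auto simp: isomorphic_to_Lex_def)
  interpret Lex_isomorphism T X r
    using X T by unfold_locales (auto simp: rev_wf_forest_finite_width_def forest_on_def)
  show ?thesis unfolding artinian_def
  proof (intro allI impI, elim conjE)
    fix J :: "nat \<Rightarrow> 'a set"
    assume J: "\<forall>n. order_ideal (J n)" and dec: "decseq J"
    show "\<exists>k. \<forall>n\<ge>k. J n = J k"
    proof (rule ccontr)
      assume not: "\<not> ?thesis"
      have "\<exists>n x. n > k \<and> x \<in> X \<and> unit x \<in> J k \<and> unit x \<notin> J n" for k
      proof -
        have "\<exists>n\<ge>k. J n \<noteq> J k" using not by simp
        then obtain n where n: "n \<ge> k" "J n \<noteq> J k" by blast
        then have "\<not> J k \<subseteq> J n" using dec by (auto simp: decseq_def)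
        then obtain x where "x \<in> X" "unit x \<in> J k" "unit x \<notin> J n"
          using ideal_subsetI J by blast
        then show ?thesis using n by (metis le_neq_implies_less)
      qed
      then obtain N x where Nx: "\<And>k. N k > k \<and> x k \<in> X \<and> unit (x k) \<in> J k \<and> unit (x k) \<notin> J (N k)"
        by metis
      \<comment> \<open>Iterating \<open>N\<close> gives \<open>N (k i) = k (Suc i)\<close>, so each
        chosen unit vector is lost no later than the next chosen index.\<close>
      define k where "k i = (N ^^ i) 0" for i
      have mono: "strict_mono k" by (rule strict_mono_Suc_iff[THEN iffD2]) (use Nx in \<open>simp add: k_def\<close>)
      obtain i j where ij: "i < j" "(x (k j), x (k i)) \<in> r"
        using rev_wf_finite_width_increasing_pair[OF X, of "x \<circ> k"] Nx by auto
      have "N (k i) = k (Suc i)" by (simp add: k_def)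
      also have "\<dots> \<le> k j" using mono ij by (simp add: strict_mono_less_eq Suc_le_eq)
      finally have "J (k j) \<subseteq> J (N (k i))" using dec by (auto simp: decseq_def)
      then have "unit (x (k j)) \<in> J (N (k i))" using Nx by blast
      moreover have "x (k j) \<in> supp (T (unit (x (k j))))" using Nx by (simp add: T_unit supp_def)
      ultimately have "unit (x (k i)) \<in> J (N (k i))"
        using unit_mem_ideal J Nx ij by blast
      then show False using Nx by blast
    qed
  qed
qed

section \<open>Artinian vector lattices are lexicographic\<close>

lemma artinianD:
  fixes I :: "nat \<Rightarrow> 'a::vector_lattice set"
  assumes "artinian TYPE('a)" "\<And>n. order_ideal (I n)" "decseq I"
  obtains k where "\<forall>n\<ge>k. I n = I k"
  using assms unfolding artinian_def by metis

text \<open>A strictly descending chain of elements yields a strictly decreasing sequence of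
  principal ideals. This drives the induction in \<open>spanning\<close> and gives reverse
  well-foundedness.\<close>

lemma wf_dominates:
  assumes "artinian TYPE('a::vector_lattice)"
  shows "wf {(y, x :: 'a). dominates x y \<and> \<not> dominates y x}"
  unfolding wf_iff_no_infinite_down_chain
proof
  assume "\<exists>f. \<forall>i. (f (Suc i), f i) \<in> {(y, x :: 'a). dominates x y \<and> \<not> dominates y x}"
  then obtain f :: "nat \<Rightarrow> 'a"
    where f: "\<And>i. dominates (f i) (f (Suc i)) \<and> \<not> dominates (f (Suc i)) (f i)"
    by blast
  define I where "I n = {y. dominates (f n) y}" for n
  have dec: "decseq I"
    unfolding decseq_Suc_iff I_def using f dominates_trans by blast
  have ideal: "order_ideal (I n)" for n unfolding I_def by (rule order_ideal_dominates)
  obtain k where k: "\<forall>n\<ge>k. I n = I k"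
    using artinianD[OF assms ideal dec] .
  have "I (Suc k) = I k" using k[rule_format, of "Suc k"] by simp
  moreover have "f k \<in> I k" by (simp add: I_def)
  ultimately have "f k \<in> I (Suc k)" by simp
  then show False using f[of k] by (simp add: I_def)
qed

lemma order_ideal_INT:
  assumes "\<And>i. i \<in> A \<Longrightarrow> order_ideal (S i)"
  shows "order_ideal (\<Inter>i\<in>A. S i)"
proof -
  have "subspace (\<Inter>i\<in>A. S i)"
    using assms by (intro subspace_Inter) (auto simp: order_ideal_def)
  moreover have "x \<in> (\<Inter>i\<in>A. S i)" if "\<bar>x\<bar> \<le> \<bar>y\<bar>" "y \<in> (\<Inter>i\<in>A. S i)" for x y
  proof
    fix i assume "i \<in> A"
    then show "x \<in> S i" using assms[of i] that unfolding order_ideal_def by blast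
  qed
  ultimately show ?thesis unfolding order_ideal_def by blast
qed

text \<open>For an infinite disjoint sequence, the common disjoint complements of the first
  \<open>n\<close> terms decrease strictly: term \<open>k\<close> lies in \<open>I k\<close> but not
  in \<open>I (Suc k)\<close>.\<close>

lemma artinian_finite_disjoint:
  fixes A :: "'a::vector_lattice set"
  assumes art: "artinian TYPE('a)" and pos: "\<And>a. a \<in> A \<Longrightarrow> 0 < a"
    and disj: "\<And>a b. a \<in> A \<Longrightarrow> b \<in> A \<Longrightarrow> a \<noteq> b \<Longrightarrow> inf a b = 0"
  shows "finite A"
proof (rule ccontr)
  assume "infinite A"
  then obtain a :: "nat \<Rightarrow> 'a" where a: "inj a" "range a \<subseteq> A"
    using infinite_countable_subset by blast
  define I where "I n = (\<Inter>i<n. {v. inf \<bar>v\<bar> \<bar>a i\<bar> = 0})" for n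
  have ideal: "order_ideal (I n)" for n
    unfolding I_def by (intro order_ideal_INT order_ideal_disjoint)
  have dec: "decseq I" by (auto simp: decseq_def I_def)
  obtain k where k: "\<forall>n\<ge>k. I n = I k"
    using artinianD[OF art ideal dec] .
  have a0: "0 < a i" for i using a pos by auto
  have absa: "\<bar>a i\<bar> = a i" for i using a0[of i] by (simp add: less_imp_le)
  have "inf (a k) (a i) = 0" if "i < k" for i
    using that a by (intro disj) (auto dest: injD)
  then have "a k \<in> I k" by (simp add: I_def absa)
  then have "a k \<in> I (Suc k)" using k[rule_format, of "Suc k"] by simp
  then have "inf (a k) (a k) = 0" by (auto simp: I_def absa lessThan_Suc)
  then show False using a0[of k] by simp
qed

section \<open>The forest of join-irreducible elements\<close>

locale artinian_lattice =
  fixes X :: "'a::vector_lattice set"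
  assumes art: "artinian TYPE('a)"
    and irr: "x \<in> X \<Longrightarrow> join_irreducible x"
    and unique: "x \<in> X \<Longrightarrow> y \<in> X \<Longrightarrow> dominates x y \<Longrightarrow> dominates y x \<Longrightarrow> x = y"
    and complete: "join_irreducible u \<Longrightarrow> \<exists>x\<in>X. dominates x u \<and> dominates u x"
begin

text \<open>Larger ideals come lower, so that the minimal elements of a support carry the dominating
  terms.\<close>

definition r :: "'a rel" where "r = {(x, y). x \<in> X \<and> y \<in> X \<and> dominates x y}"

lemma partial_order: "partial_order_on X r"
  unfolding partial_order_on_def preorder_on_def refl_on_def trans_def antisym_def r_def
  using dominates_trans unique by auto

text \<open>Two elements that both dominate some \<open>x > 0\<close> cannot be disjoint, so they
  are comparable.\<close>

lemma forest: "forest_on X r"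
  unfolding forest_on_def
proof (intro conjI ballI partial_order)
  fix x assume x: "x \<in> X"
  have "dominates y z \<or> dominates z y" if h: "y \<in> X" "z \<in> X" "dominates y x" "dominates z x" for y z
  proof -
    have pos: "0 < x" "0 < y" "0 < z" using that x irr join_irreducible_pos by auto
    then have pos': "0 \<le> x" "0 \<le> y" "0 \<le> z" by simp_all
    obtain c where c: "c > 0" "x \<le> c *\<^sub>R y"
      using h(3) abs_of_nonneg[OF pos'(1)] abs_of_nonneg[OF pos'(2)] unfolding dominates_def by auto
    obtain d where d: "d > 0" "x \<le> d *\<^sub>R z"
      using h(4) abs_of_nonneg[OF pos'(1)] abs_of_nonneg[OF pos'(3)] unfolding dominates_def by auto
    have "inf y z \<noteq> 0"
    proof
      assume "inf y z = 0"
      then have "inf y x = 0" using inf_scaleR_zero[of y z x d] d pos' by blast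
      then have "inf x y = 0" by (simp add: inf_commute)
      then have "inf x x = 0" using inf_scaleR_zero[of x y x c] c pos' by blast
      then show False using pos by simp
    qed
    then show ?thesis using join_irreducible_comparable_or_disjoint irr that by blast
  qed
  then show "total_on {y \<in> X. (y, x) \<in> r} r"
    by (auto simp: total_on_def r_def)
qed

lemma rev_well_founded: "well_founded_on X (r\<inverse>)"
  unfolding well_founded_on_def
proof (intro allI impI)
  fix S assume S: "S \<subseteq> X" "S \<noteq> {}"
  then obtain m where m: "m \<in> S" "\<And>y. dominates m y \<and> \<not> dominates y m \<Longrightarrow> y \<notin> S"
    using wfE_min'[OF wf_dominates[OF art], of S] by auto
  then have "minimal_in (r\<inverse>) S m"
    using S unique by (auto simp: minimal_in_def r_def)
  then show "\<exists>m. minimal_in (r\<inverse>) S m" by blast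
qed

text \<open>Incomparable join-irreducible elements are disjoint.\<close>

lemma finite_width: "finite_width X r"
  unfolding finite_width_def
proof (intro allI impI)
  fix A assume A: "antichain_on X r A"
  show "finite A"
  proof (rule artinian_finite_disjoint[OF art])
    fix a assume "a \<in> A"
    then show "0 < a" using A irr join_irreducible_pos by (auto simp: antichain_on_def)
  next
    fix a b assume "a \<in> A" "b \<in> A" "a \<noteq> b"
    then show "inf a b = 0"
      using A irr join_irreducible_comparable_or_disjoint[of a b]
      unfolding antichain_on_def r_def by blast
  qed
qed

text \<open>By minimality no other term dominates \<open>m\<close>, and the elements that do not
  dominate \<open>m\<close> form a subspace.\<close>

lemma minimal_coefficient:
  assumes S: "finite S" "S \<subseteq> X" and m: "minimal_in r S m" and v: "v = (\<Sum>x\<in>S. c x *\<^sub>R x)"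
  shows "\<not> dominates (v - c m *\<^sub>R m) m"
proof -
  have mS: "m \<in> S" using m by (simp add: minimal_in_def)
  then have sub: "subspace {v. \<not> dominates v m}"
    using subspace_not_dominates irr S by blast
  have "v - c m *\<^sub>R m = (\<Sum>x\<in>S - {m}. c x *\<^sub>R x)"
    using S mS by (simp add: v sum.remove)
  also have "\<dots> \<in> {v. \<not> dominates v m}"
  proof (rule subspace_sum[OF sub])
    fix x assume "x \<in> S - {m}"
    then have "x \<in> {v. \<not> dominates v m}" using m S mS by (auto simp: minimal_in_def r_def)
    then show "c x *\<^sub>R x \<in> {v. \<not> dominates v m}" using sub by (rule subspace_scale[rotated])
  qed
  finally show ?thesis by simp
qed

text \<open>If \<open>c m\<close> were negative, the remaining terms would sum to at least
  \<open>- c m\<close> times \<open>m\<close> and so dominate \<open>m\<close>, against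
  \<open>minimal_coefficient\<close>.\<close>

lemma minimal_coefficient_nonneg:
  assumes S: "finite S" "S \<subseteq> X" and m: "minimal_in r S m" and nonneg: "0 \<le> (\<Sum>x\<in>S. c x *\<^sub>R x)"
  shows "0 \<le> c m"
proof (rule ccontr)
  assume neg: "\<not> 0 \<le> c m"
  define n where "n = (\<Sum>x\<in>S. c x *\<^sub>R x) - c m *\<^sub>R m"
  have mS: "m \<in> S" using m by (simp add: minimal_in_def)
  then have "0 < m" using irr join_irreducible_pos S by blast
  then have m0: "0 \<le> - c m *\<^sub>R m" using neg by (intro scaleR_nonneg_nonneg) auto
  have "- c m *\<^sub>R m \<le> n" using nonneg by (simp add: n_def)
  with m0 have "\<bar>- c m *\<^sub>R m\<bar> \<le> \<bar>n\<bar>" by (simp add: order_trans[OF _ abs_ge_self] del: scaleR_minus_left)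
  then have "dominates n (- c m *\<^sub>R m)" by (rule dominates_mono)
  moreover have "dominates (- c m *\<^sub>R m) m"
    using dominates_scaleR[of "- c m *\<^sub>R m" "- (1 / c m)"] neg by simp
  ultimately show False
    using minimal_coefficient[OF S m refl] dominates_trans unfolding n_def by blast
qed

text \<open>In a relation with nonzero coefficients, the terms other than a minimal \<open>m\<close>
  sum to \<open>- c m\<close> times \<open>m\<close>. This dominates \<open>m\<close>, against
  \<open>minimal_coefficient\<close>.\<close>

lemma independent: "independent X"
  unfolding independent_explicit_finite_subsets
proof (intro allI impI ballI)
  fix S c x assume S: "S \<subseteq> X" "finite S" and zero: "(\<Sum>v\<in>S. c v *\<^sub>R v) = 0" and x: "x \<in> S"
  show "c x = 0"
  proof (rule ccontr)
    assume cx: "c x \<noteq> 0"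
    define S' where "S' = {y \<in> S. c y \<noteq> 0}"
    have S': "finite S'" "S' \<subseteq> X" "x \<in> S'" using S x cx by (auto simp: S'_def)
    then obtain m where m: "minimal_in r S' m"
      using finite_minimal_in_below[OF partial_order] by metis
    then have cm: "c m \<noteq> 0" by (auto simp: minimal_in_def S'_def)
    have eq: "(\<Sum>v\<in>S'. c v *\<^sub>R v) = 0"
      using zero S unfolding S'_def by (subst sum.mono_neutral_left[of S]) auto
    have "\<not> dominates (- (c m *\<^sub>R m)) m"
      using minimal_coefficient[OF S'(1,2) m eq[symmetric]] by simp
    moreover have "dominates (c m *\<^sub>R m) m"
      using dominates_scaleR[of "c m *\<^sub>R m" "1 / c m"] cm by simp
    ultimately show False by simp
  qed
qed

lemma spanning: "v \<in> span X"
proof -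
  have nonneg: "v \<in> span X" if "0 \<le> v" for v
    using wf_dominates[OF art] that
  proof (induction v rule: wf_induct_rule)
    case (less v)
    \<comment> \<open>The induction hypothesis speaks of nonnegative elements only; positive and
      negative parts carry it over to all \<open>w\<close>.\<close>
    have IH: "w \<in> span X" if w: "dominates v w" "\<not> dominates w v" for w
    proof -
      have "dominates w (pprt w)" "dominates w (nprt w)"
        by (auto intro!: dominates_mono simp: abs_prts)
      then have "pprt w \<in> span X" "- nprt w \<in> span X"
        using w dominates_trans by (auto intro!: less.IH dest: dominates_trans)
      then have "pprt w - (- nprt w) \<in> span X" by (rule span_diff)
      then show ?thesis using prts[of w] by simp
    qed
    consider "v = 0" | "join_irreducible v" | "0 < v" "\<not> join_irreducible v"
      using less.prems by force
    then show ?case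
    proof cases
      case 1 then show ?thesis by (simp add: span_zero)
    next
      case 2
      then obtain x where x: "x \<in> X" "dominates x v" "dominates v x" using complete by blast
      obtain l where l: "\<not> dominates (v - l *\<^sub>R x) x"
        using join_irreducible_scaleR_approx[OF irr[OF x(1)] less.prems x(2)] .
      have "dominates v (- (l *\<^sub>R x))" using dominates_trans[OF x(3) dominates_scaleR] by simp
      then have "dominates v (v - l *\<^sub>R x)" using dominates_add[of v v "- (l *\<^sub>R x)"] by simp
      then have "v - l *\<^sub>R x \<in> span X" using IH l x dominates_trans by blast
      then have "(v - l *\<^sub>R x) + l *\<^sub>R x \<in> span X"
        by (rule span_add[OF _ span_scale[OF span_base[OF x(1)]]])
      then show ?thesis by simp
    next
      case 3
      then obtain a b where ab: "0 \<le> a" "0 \<le> b" "v = a + b" "\<not> dominates a v" "\<not> dominates b v"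
        unfolding join_irreducible_def by auto
      then have "dominates v a" "dominates v b" by (auto intro!: dominates_mono)
      then show ?thesis using ab IH by (auto intro: span_add)
    qed
  qed
  have "pprt v - (- nprt v) \<in> span X" by (intro span_diff nonneg) auto
  then show ?thesis using prts[of v] by simp
qed

text \<open>The sum splits into the parts above the minimal elements, and each part has the sign of
  its leading coefficient because its leading term generates the same ideal as the part.\<close>

lemma nonneg_if_minimal_coefficients_pos:
  assumes "finite S" "S \<subseteq> X" "\<And>m. minimal_in r S m \<Longrightarrow> 0 < c m"
  shows "0 \<le> (\<Sum>x\<in>S. c x *\<^sub>R x)"
  using assms
proof (induction S rule: finite_psubset_induct)
  case (psubset S)
  have tr: "trans r" "refl_on X r"
    using partial_order by (auto simp: partial_order_on_def preorder_on_def)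
  show ?case
  proof (cases "S = {}")
    case False
    then obtain m where m: "minimal_in r S m"
      using finite_minimal_in_below[OF partial_order psubset.hyps psubset.prems(1)]
      by (metis all_not_in_conv)
    then have mS: "m \<in> S" and cm: "0 < c m" using psubset.prems by (auto simp: minimal_in_def)
    define A where "A = {y \<in> S. (m, y) \<in> r}"
    define w where "w = (\<Sum>x\<in>A. c x *\<^sub>R x)"
    have A: "A \<subseteq> S" "m \<in> A" "finite A"
      using mS tr psubset by (auto simp: A_def refl_on_def)
    have minA: "minimal_in r A m" using m A by (auto simp: minimal_in_def)
    have m0: "join_irreducible m" "0 < m" using irr join_irreducible_pos mS psubset.prems by auto
    have n: "\<not> dominates (w - c m *\<^sub>R m) m"
      by (rule minimal_coefficient[OF A(3) _ minA]) (use A psubset.prems in \<open>auto simp: w_def\<close>)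
    have cmm: "dominates (c m *\<^sub>R m) m"
      using dominates_scaleR[of "c m *\<^sub>R m" "1 / c m"] cm by simp
    have mw: "dominates m w"
    proof -
      have "w \<in> {y. dominates m y}" unfolding w_def
      proof (rule subspace_sum)
        show "subspace {y. dominates m y}" using order_ideal_dominates[of m] by (simp add: order_ideal_def)
        fix x assume "x \<in> A"
        then show "c x *\<^sub>R x \<in> {y. dominates m y}"
          using dominates_trans[OF _ dominates_scaleR] by (auto simp: A_def r_def)
      qed
      then show ?thesis by simp
    qed
    \<comment> \<open>The leading term is the sum of \<open>c m *\<^sub>R m - w\<close> and
      \<open>w\<close>. The first summand does not dominate \<open>m\<close>, so \<open>w\<close>
      does.\<close>
    have "dominates (c m *\<^sub>R m - w) m \<or> dominates w m"
      using join_irreducible_split[OF m0(1), of "c m *\<^sub>R m - w" w] cmm by simp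
    then have wm: "dominates w m" using n dominates_minus(1)[of "w - c m *\<^sub>R m" m] by simp
    have "0 \<le> w"
    proof (rule ccontr)
      assume "\<not> 0 \<le> w"
      then have "w \<le> 0" using join_irreducible_nonneg_or_nonpos[OF m0(1) mw wm] by simp
      \<comment> \<open>Subtracting a nonpositive \<open>w\<close> would only enlarge the leading
        term, so the difference would dominate \<open>m\<close>, against \<open>n\<close>.\<close>
      then have "c m *\<^sub>R m \<le> c m *\<^sub>R m - w" by simp
      moreover have "0 \<le> c m *\<^sub>R m" using cm m0 by (intro scaleR_nonneg_nonneg) auto
      ultimately have "dominates (c m *\<^sub>R m - w) (c m *\<^sub>R m)"
        by (intro dominates_mono) (simp add: order_trans)
      then show False
        using n cmm dominates_trans dominates_minus(1)[of "w - c m *\<^sub>R m" m] by (metis minus_diff_eq)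
    qed
    moreover have "0 \<le> (\<Sum>x\<in>S - A. c x *\<^sub>R x)"
    proof (rule psubset.IH)
      show "S - A \<subset> S" "S - A \<subseteq> X" using A psubset.prems by auto
      fix p assume p: "minimal_in r (S - A) p"
      \<comment> \<open>An element of \<open>A\<close> below \<open>p\<close> would put
        \<open>p\<close> into \<open>A\<close>, so passing from \<open>S - A\<close> to
        \<open>S\<close> adds nothing below \<open>p\<close>.\<close>
      have "minimal_in r S p"
        using p tr(1) unfolding minimal_in_def A_def trans_def by blast
      then show "0 < c p" by (rule psubset.prems)
    qed
    moreover have "(\<Sum>x\<in>S. c x *\<^sub>R x) = (\<Sum>x\<in>S - A. c x *\<^sub>R x) + w"
      unfolding w_def by (rule sum.subset_diff[OF A(1) psubset.hyps])
    ultimately show ?thesis by simp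
  qed simp
qed

section \<open>Coordinates with respect to the basis \<open>X\<close>\<close>

abbreviation T :: "'a \<Rightarrow> 'a \<Rightarrow> real" where "T \<equiv> representation X"

lemma T_diff: "T (u - v) = (\<lambda>x. T u x - T v x)"
  using representation_diff[OF independent] spanning by blast

lemma T_in_Lex: "T v \<in> Lex X r"
  using representation_ne_zero finite_representation
  by (subst Lex_iff[OF partial_order]) (auto simp: supp_def)

lemma T_expansion: "(\<Sum>x\<in>supp (T v). T v x *\<^sub>R x) = v"
  using sum_nonzero_representation_eq[OF independent spanning] by (simp add: supp_def)

lemma nonneg_iff: "0 \<le> v \<longleftrightarrow> T v \<in> lex_cone X r"
proof -
  have S: "finite (supp (T v))" "supp (T v) \<subseteq> X"
    using T_in_Lex Lex_iff[OF partial_order] by auto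
  have "T v m > 0" if "0 \<le> v" "minimal_in r (supp (T v)) m" for m
  proof -
    have "0 \<le> T v m"
      using minimal_coefficient_nonneg[OF S that(2), of "T v"] that(1) by (simp add: T_expansion)
    then show ?thesis using that by (auto simp: minimal_in_def supp_def)
  qed
  moreover have "0 \<le> v" if "\<And>m. minimal_in r (supp (T v)) m \<Longrightarrow> T v m > 0"
    using nonneg_if_minimal_coefficients_pos[OF S, of "T v"] that by (simp add: T_expansion)
  ultimately show ?thesis using T_in_Lex by (auto simp: lex_cone_def Lex_def)
qed

lemma le_iff: "u \<le> v \<longleftrightarrow> lex_le X r (T u) (T v)"
  using nonneg_iff[of "v - u"] by (simp add: lex_le_def T_diff)

lemma T_bij: "bij_betw T UNIV (Lex X r)"
  unfolding bij_betw_def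
proof
  show "inj T" by (rule injI) (metis T_expansion)
  have "f \<in> range T" if f: "f \<in> Lex X r" for f
  proof
    have S: "finite (supp f)" "supp f \<subseteq> X" using f Lex_iff[OF partial_order] by auto
    show "f = T (\<Sum>x\<in>supp f. f x *\<^sub>R x)"
      by (rule sym, rule representation_eqI[OF independent spanning]) (use S in \<open>auto simp: supp_def\<close>)
  qed simp
  then show "range T = Lex X r" using T_in_Lex by blast
qed

text \<open>By \<open>le_iff\<close> the bijection \<open>T\<close> preserves and reflects the
  order, so it carries joins and meets to joins and meets.\<close>

lemma isomorphic: "lattice_iso_Lex T X r"
  unfolding lattice_iso_Lex_def
proof (intro conjI allI T_bij)
  fix x show "linear (\<lambda>v. T v x)"
    by (rule linearI)
      (simp_all add: representation_add[OF independent] representation_scale[OF independent] spanning)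
next
  have Lex: "Lex X r = range T" using T_bij by (simp add: bij_betw_def)
  fix u v
  show "is_join (Lex X r) (lex_le X r) (T u) (T v) (T (sup u v))"
    unfolding is_join_def Lex ball_simps le_iff[symmetric] by simp
  show "is_meet (Lex X r) (lex_le X r) (T u) (T v) (T (inf u v))"
    unfolding is_meet_def Lex ball_simps le_iff[symmetric] by simp
qed

end

lemma isomorphic_to_Lex_if_artinian:
  assumes "artinian TYPE('a::vector_lattice)"
  shows "\<exists>(X :: 'a set) r. rev_wf_forest_finite_width X r \<and> isomorphic_to_Lex TYPE('a) X r"
proof -
  define rep :: "'a \<Rightarrow> 'a"
    where "rep v = (SOME u. join_irreducible u \<and> dominates u v \<and> dominates v u)" for v
  have rep: "join_irreducible (rep v) \<and> dominates (rep v) v \<and> dominates v (rep v)"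
    if "join_irreducible v" for v
    unfolding rep_def by (rule someI[of _ v]) (simp add: that)
  interpret artinian_lattice "rep ` {v. join_irreducible v}"
  proof
    fix x y assume x: "x \<in> rep ` {v. join_irreducible v}" and y: "y \<in> rep ` {v. join_irreducible v}"
      and xy: "dominates x y" "dominates y x"
    obtain u v where u: "x = rep u" "join_irreducible u" and v: "y = rep v" "join_irreducible v"
      using x y by auto
    have "dominates u v" "dominates v u" using rep[OF u(2)] rep[OF v(2)] xy u v dominates_trans by metis+
    \<comment> \<open>\<open>rep\<close> depends only on the predicate under \<open>SOME\<close>,
      which is the same for mutually dominating \<open>u\<close> and \<open>v\<close>.\<close>
    then have "(join_irreducible w \<and> dominates w u \<and> dominates u w) =
        (join_irreducible w \<and> dominates w v \<and> dominates v w)" for w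
      using dominates_trans by blast
    then have "rep u = rep v" unfolding rep_def by simp
    then show "x = y" using u v by simp
  qed (use assms rep in auto)
  show ?thesis
    using forest rev_well_founded finite_width isomorphic
    unfolding rev_wf_forest_finite_width_def isomorphic_to_Lex_def by blast
qed

text \<open>Types cannot be quantified inside a statement. The existential therefore uses carriers
  in \<open>'a\<close>, where the construction places its forest, and the second conjunct treats
  carriers in an arbitrary type \<open>'b\<close>.\<close>

theorem theorem5p5:
  shows "(artinian TYPE('a::vector_lattice) \<longleftrightarrow>
            (\<exists>(X :: 'a set) r.
               rev_wf_forest_finite_width X r \<and> isomorphic_to_Lex TYPE('a) X r)) \<and>
         (\<forall>(X :: 'b set) r.
            rev_wf_forest_finite_width X r \<and> isomorphic_to_Lex TYPE('a) X r
              \<longrightarrow> artinian TYPE('a))"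
proof (intro conjI iffI allI impI)
  assume "artinian TYPE('a)"
  then show "\<exists>(X :: 'a set) r. rev_wf_forest_finite_width X r \<and> isomorphic_to_Lex TYPE('a) X r"
    by (rule isomorphic_to_Lex_if_artinian)
qed (auto intro: artinian_if_isomorphic_to_Lex)

end
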